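(* The (real) space $\ell_p$ fails property (D) whenever $1\le p<2$; that is, for each $1\le p<2$ there is a continuous quadratic form on $\ell_p$ which is not delta-semidefinite.
   Context: A function $q\colon X\to\mathbb{R}$ on a real Banach space $X$ is a continuous quadratic form if there is a continuous bilinear form $b\colon X\times X\to\mathbb{R}$ with $q(x)=b(x,x)$ for all $x$. It is delta-semidefinite if it is the difference of two nonnegative continuous quadratic forms on $X$. Property (D) of $X$: each continuous quadratic form on $X$ is delta-semidefinite. *)

theory Defs
  imports "HOL-Analysis.Analysis" "HOL-Library.Function_Algebras"
begin

instantiation "fun" :: (type, real_vector) real_vector
begin

definition scaleR_fun :: "real \<Rightarrow> ('a \<Rightarrow> 'b) \<Rightarrow> 'a \<Rightarrow> 'b"
  where "scaleR_fun c f = (\<lambda>x. c *\<^sub>R f x)"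

instance
  by standard (auto simp: scaleR_fun_def fun_eq_iff scaleR_add_right scaleR_add_left)

end

text \<open>
  Since the exponent of \<open>\<ell>\<^sub>p\<close> is a real variable, the space cannot be a type of class \<open>banach\<close>.
  A real Banach space is therefore a linear subspace \<open>X\<close> of a real vector space together with a
  function \<open>N\<close> that is a complete norm on \<open>X\<close>; only the values on \<open>X\<close> of \<open>N\<close> and of the forms
  below are relevant.
\<close>

definition norm_metric :: "('a::real_vector \<Rightarrow> real) \<Rightarrow> 'a \<Rightarrow> 'a \<Rightarrow> real"
  where "norm_metric N x y = N (x - y)"

definition norm_topology :: "'a::real_vector set \<Rightarrow> ('a \<Rightarrow> real) \<Rightarrow> 'a topology"
  where "norm_topology X N = Metric_space.mtopology X (norm_metric N)"

text \<open>
  The conjunct \<^term>\<open>Metric_space X (norm_metric N)\<close> is redundant on \<open>X\<close>. It also asks that the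
  values of \<open>norm_metric N\<close> outside \<open>X\<close> are nonnegative and symmetric, as the library's locale does;
  the constants of that locale are unspecified otherwise.
\<close>

definition real_banach_on :: "'a::real_vector set \<Rightarrow> ('a \<Rightarrow> real) \<Rightarrow> bool"
  where "real_banach_on X N \<longleftrightarrow>
    subspace X \<and>
    (\<forall>x\<in>X. 0 \<le> N x \<and> (N x = 0 \<longleftrightarrow> x = 0)) \<and>
    (\<forall>c. \<forall>x\<in>X. N (c *\<^sub>R x) = \<bar>c\<bar> * N x) \<and>
    (\<forall>x\<in>X. \<forall>y\<in>X. N (x + y) \<le> N x + N y) \<and>
    Metric_space X (norm_metric N) \<and>
    Metric_space.mcomplete X (norm_metric N)"

definition bilinear_on :: "'a::real_vector set \<Rightarrow> ('a \<Rightarrow> 'a \<Rightarrow> real) \<Rightarrow> bool"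
  where "bilinear_on X b \<longleftrightarrow>
    (\<forall>x\<in>X. \<forall>y\<in>X. \<forall>z\<in>X. b (x + y) z = b x z + b y z \<and> b z (x + y) = b z x + b z y) \<and>
    (\<forall>c. \<forall>x\<in>X. \<forall>y\<in>X. b (c *\<^sub>R x) y = c * b x y \<and> b x (c *\<^sub>R y) = c * b x y)"

definition continuous_bilinear_form :: "'a::real_vector set \<Rightarrow> ('a \<Rightarrow> real) \<Rightarrow> ('a \<Rightarrow> 'a \<Rightarrow> real) \<Rightarrow> bool"
  where "continuous_bilinear_form X N b \<longleftrightarrow>
    bilinear_on X b \<and>
    continuous_map (prod_topology (norm_topology X N) (norm_topology X N)) euclideanreal
      (\<lambda>(x, y). b x y)"

definition continuous_quadratic_form :: "'a::real_vector set \<Rightarrow> ('a \<Rightarrow> real) \<Rightarrow> ('a \<Rightarrow> real) \<Rightarrow> bool"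
  where "continuous_quadratic_form X N q \<longleftrightarrow>
    (\<exists>b. continuous_bilinear_form X N b \<and> (\<forall>x\<in>X. q x = b x x))"

definition delta_semidefinite :: "'a::real_vector set \<Rightarrow> ('a \<Rightarrow> real) \<Rightarrow> ('a \<Rightarrow> real) \<Rightarrow> bool"
  where "delta_semidefinite X N q \<longleftrightarrow>
    (\<exists>q1 q2. continuous_quadratic_form X N q1 \<and> continuous_quadratic_form X N q2 \<and>
      (\<forall>x\<in>X. 0 \<le> q1 x) \<and> (\<forall>x\<in>X. 0 \<le> q2 x) \<and>
      (\<forall>x\<in>X. q x = q1 x - q2 x))"

definition property_D :: "'a::real_vector set \<Rightarrow> ('a \<Rightarrow> real) \<Rightarrow> bool"
  where "property_D X N \<longleftrightarrow>
    (\<forall>q. continuous_quadratic_form X N q \<longrightarrow> delta_semidefinite X N q)"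

definition lp_space :: "real \<Rightarrow> (nat \<Rightarrow> real) set"
  where "lp_space p = {x. summable (\<lambda>n. \<bar>x n\<bar> powr p)}"

definition lp_norm :: "real \<Rightarrow> (nat \<Rightarrow> real) \<Rightarrow> real"
  where "lp_norm p x = (\<Sum>n. \<bar>x n\<bar> powr p) powr (1 / p)"

subsection \<open>The sequence spaces are Banach spaces\<close>

lemma lp_norm_nonneg [simp]: "0 \<le> lp_norm p x"
  by (simp add: lp_norm_def)

lemma lp_norm_powr:
  assumes "1 \<le> p" "x \<in> lp_space p"
  shows "lp_norm p x powr p = (\<Sum>n. \<bar>x n\<bar> powr p)"
proof -
  have "0 \<le> (\<Sum>n. \<bar>x n\<bar> powr p)"
    using assms by (intro suminf_nonneg) (auto simp: lp_space_def)
  then show ?thesis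
    using assms by (simp add: lp_norm_def powr_powr)
qed

lemma lp_norm_leI:
  assumes p: "1 \<le> p" and c: "0 \<le> c"
    and le: "\<And>k. (\<Sum>n<k. \<bar>x n\<bar> powr p) \<le> c powr p"
  shows "x \<in> lp_space p" "lp_norm p x \<le> c"
proof -
  have s: "summable (\<lambda>n. \<bar>x n\<bar> powr p)"
    by (rule summableI_nonneg_bounded[where x = "c powr p"]) (use le in auto)
  then show x: "x \<in> lp_space p"
    by (simp add: lp_space_def)
  have "(\<Sum>n. \<bar>x n\<bar> powr p) \<le> c powr p"
    using s le by (intro suminf_le_const) auto
  then have "lp_norm p x powr p \<le> c powr p"
    using lp_norm_powr[OF p x] by simp
  then show "lp_norm p x \<le> c"
    using p c lp_norm_nonneg[of p x] powr_less_mono2[of p c "lp_norm p x"] by force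
qed

lemma lp_partial_sum_le:
  assumes "1 \<le> p" "x \<in> lp_space p"
  shows "(\<Sum>n<k. \<bar>x n\<bar> powr p) \<le> lp_norm p x powr p"
  unfolding lp_norm_powr[OF assms]
  using assms by (intro sum_le_suminf) (auto simp: lp_space_def)

lemma lp_coord_le:
  assumes "1 \<le> p" "x \<in> lp_space p"
  shows "\<bar>x n\<bar> \<le> lp_norm p x"
proof -
  have "\<bar>x n\<bar> powr p \<le> (\<Sum>n<Suc n. \<bar>x n\<bar> powr p)"
    by (simp add: sum_nonneg)
  also have "\<dots> \<le> lp_norm p x powr p"
    by (rule lp_partial_sum_le[OF assms])
  finally show ?thesis
    using assms(1) lp_norm_nonneg[of p x] powr_less_mono2[of p "lp_norm p x" "\<bar>x n\<bar>"] by force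
qed

lemma lp_norm_eq_0:
  assumes "1 \<le> p" "x \<in> lp_space p"
  shows "lp_norm p x = 0 \<longleftrightarrow> x = 0"
proof
  assume "lp_norm p x = 0"
  then show "x = 0"
    using lp_coord_le[OF assms] by (auto simp: fun_eq_iff)
qed (auto simp: lp_norm_def)

lemma powr_convex_comb:
  fixes s t u v p :: real
  assumes "1 \<le> p" "0 \<le> s" "0 \<le> t" "s + t = 1" "0 \<le> u" "0 \<le> v"
  shows "(s * u + t * v) powr p \<le> s * u powr p + t * v powr p"
proof -
  have c: "c powr p \<le> c" if "0 \<le> c" "c \<le> 1" for c :: real
    using powr_mono'[of 1 p c] that assms(1) by simp
  consider "u = 0" | "v = 0" | "0 < u" "0 < v"
    using assms by fastforce
  then show ?thesis
  proof cases
    case 1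
    then show ?thesis
      using c[of t] assms by (simp add: powr_mult mult_right_mono)
  next
    case 2
    then show ?thesis
      using c[of s] assms by (simp add: powr_mult mult_right_mono)
  next
    case 3
    have s: "s = 1 - t" and t: "t \<le> 1"
      using assms by auto
    show ?thesis
      unfolding s
      using convex_onD[OF powr_convex[OF assms(1)], of t u v] 3 assms(3) t by auto
  qed
qed

lemma lp_minkowski:
  assumes p: "1 \<le> p" and x: "x \<in> lp_space p" and y: "y \<in> lp_space p"
  shows "x + y \<in> lp_space p" "lp_norm p (x + y) \<le> lp_norm p x + lp_norm p y"
proof -
  define A B where "A = lp_norm p x" and "B = lp_norm p y"
  have nn: "0 \<le> A" "0 \<le> B"
    by (simp_all add: A_def B_def)
  have "x + y \<in> lp_space p \<and> lp_norm p (x + y) \<le> A + B"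
  proof (cases "A = 0 \<or> B = 0")
    case True
    then have "x = 0 \<or> y = 0"
      using lp_norm_eq_0 p x y by (auto simp: A_def B_def)
    then show ?thesis
      using x y nn by (auto simp: A_def B_def)
  next
    case False
    then have pos: "0 < A" "0 < B"
      using nn by auto
    define s t where "s = A / (A + B)" and "t = B / (A + B)"
    have st: "0 \<le> s" "0 \<le> t" "s + t = 1"
      using pos by (auto simp: s_def t_def add_divide_distrib[symmetric])
    have le: "\<bar>(x + y) n\<bar> powr p \<le>
        (A + B) powr p * (s * (\<bar>x n\<bar> powr p / A powr p) + t * (\<bar>y n\<bar> powr p / B powr p))" for n
    proof -
      have "\<bar>(x + y) n\<bar> \<le> (A + B) * (s * (\<bar>x n\<bar> / A) + t * (\<bar>y n\<bar> / B))"
      proof -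
        have "(A + B) * (s * (\<bar>x n\<bar> / A) + t * (\<bar>y n\<bar> / B)) = \<bar>x n\<bar> + \<bar>y n\<bar>"
          using pos by (simp add: s_def t_def distrib_left)
        then show ?thesis
          by simp
      qed
      then have "\<bar>(x + y) n\<bar> powr p \<le> ((A + B) * (s * (\<bar>x n\<bar> / A) + t * (\<bar>y n\<bar> / B))) powr p"
        using p by (intro powr_mono2) auto
      also have "\<dots> = (A + B) powr p * (s * (\<bar>x n\<bar> / A) + t * (\<bar>y n\<bar> / B)) powr p"
        using pos st by (simp add: powr_mult)
      also have "\<dots> \<le> (A + B) powr p * (s * (\<bar>x n\<bar> / A) powr p + t * (\<bar>y n\<bar> / B) powr p)"
        using p pos st by (intro mult_left_mono powr_convex_comb) auto
      finally show ?thesis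
        using pos by (simp add: powr_divide)
    qed
    have "(\<Sum>n<k. \<bar>(x + y) n\<bar> powr p) \<le> (A + B) powr p" for k
    proof -
      have "(\<Sum>n<k. \<bar>(x + y) n\<bar> powr p) \<le>
          (\<Sum>n<k. (A + B) powr p * (s * (\<bar>x n\<bar> powr p / A powr p) + t * (\<bar>y n\<bar> powr p / B powr p)))"
        by (intro sum_mono le)
      also have "\<dots> = (A + B) powr p *
          (s * ((\<Sum>n<k. \<bar>x n\<bar> powr p) / A powr p) + t * ((\<Sum>n<k. \<bar>y n\<bar> powr p) / B powr p))"
        by (simp only: sum_distrib_left[symmetric] sum.distrib sum_divide_distrib[symmetric])
      also have "\<dots> \<le> (A + B) powr p * (s * 1 + t * 1)"
        using pos st lp_partial_sum_le[OF p x, of k] lp_partial_sum_le[OF p y, of k]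
        by (intro mult_left_mono add_mono) (auto simp: A_def B_def divide_simps)
      finally show ?thesis
        using st by simp
    qed
    then show ?thesis
      using lp_norm_leI[of p "A + B" "x + y"] p nn by auto
  qed
  then show "x + y \<in> lp_space p" "lp_norm p (x + y) \<le> lp_norm p x + lp_norm p y"
    by (simp_all add: A_def B_def)
qed

lemma lp_scaleR:
  assumes "1 \<le> p" "x \<in> lp_space p"
  shows "c *\<^sub>R x \<in> lp_space p" "lp_norm p (c *\<^sub>R x) = \<bar>c\<bar> * lp_norm p x"
proof -
  have eq: "\<bar>(c *\<^sub>R x) n\<bar> powr p = \<bar>c\<bar> powr p * \<bar>x n\<bar> powr p" for n
    by (simp add: scaleR_fun_def abs_mult powr_mult)
  have s: "summable (\<lambda>n. \<bar>x n\<bar> powr p)"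
    using assms by (simp add: lp_space_def)
  then show "c *\<^sub>R x \<in> lp_space p"
    by (simp add: lp_space_def eq)
  show "lp_norm p (c *\<^sub>R x) = \<bar>c\<bar> * lp_norm p x"
    using assms s by (simp add: lp_norm_def eq suminf_mult powr_mult suminf_nonneg powr_powr)
qed

lemma subspace_lp_space:
  assumes "1 \<le> p"
  shows "subspace (lp_space p)"
proof (rule subspaceI)
  show "0 \<in> lp_space p"
    by (simp add: lp_space_def)
qed (fact lp_minkowski(1)[OF assms] lp_scaleR(1)[OF assms])+

lemma Metric_space_lp:
  assumes p: "1 \<le> p"
  shows "Metric_space (lp_space p) (norm_metric (lp_norm p))"
proof
  show "norm_metric (lp_norm p) x y = norm_metric (lp_norm p) y x" for x y
    by (simp add: norm_metric_def lp_norm_def abs_minus_commute)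
  show "norm_metric (lp_norm p) x y = 0 \<longleftrightarrow> x = y"
    if "x \<in> lp_space p" "y \<in> lp_space p" for x y
    using lp_norm_eq_0[OF p subspace_diff[OF subspace_lp_space[OF p] that]]
    by (simp add: norm_metric_def)
  show "norm_metric (lp_norm p) x z \<le> norm_metric (lp_norm p) x y + norm_metric (lp_norm p) y z"
    if "x \<in> lp_space p" "y \<in> lp_space p" "z \<in> lp_space p" for x y z
  proof -
    have "x - y \<in> lp_space p" "y - z \<in> lp_space p"
      using subspace_diff[OF subspace_lp_space[OF p]] that by auto
    from lp_minkowski(2)[OF p this] show ?thesis
      by (simp add: norm_metric_def)
  qed
qed (simp add: norm_metric_def)

lemma mcomplete_lp:
  assumes p: "1 \<le> p"
  shows "Metric_space.mcomplete (lp_space p) (norm_metric (lp_norm p))"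
proof -
  interpret Metric_space "lp_space p" "norm_metric (lp_norm p)"
    by (rule Metric_space_lp[OF p])
  note sub = subspace_diff[OF subspace_lp_space[OF p]]
  show ?thesis
    unfolding mcomplete_def
  proof (intro allI impI)
    fix \<sigma> assume C: "MCauchy \<sigma>"
    have mem: "\<sigma> i \<in> lp_space p" for i
      using C by (auto simp: MCauchy_def)
    have cau: "\<exists>M. \<forall>i j. M \<le> i \<longrightarrow> M \<le> j \<longrightarrow> lp_norm p (\<sigma> i - \<sigma> j) < e" if "0 < e" for e
      using C that by (simp add: MCauchy_def norm_metric_def)
    have "convergent (\<lambda>i. \<sigma> i n)" for n
    proof -
      have "\<exists>M. \<forall>i\<ge>M. \<forall>j\<ge>M. norm (\<sigma> i n - \<sigma> j n) < e" if e: "0 < e" for e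
      proof -
        obtain M where M: "\<forall>i j. M \<le> i \<longrightarrow> M \<le> j \<longrightarrow> lp_norm p (\<sigma> i - \<sigma> j) < e"
          using cau[OF e] by blast
        have "norm (\<sigma> i n - \<sigma> j n) < e" if "M \<le> i" "M \<le> j" for i j
        proof -
          have "\<bar>(\<sigma> i - \<sigma> j) n\<bar> \<le> lp_norm p (\<sigma> i - \<sigma> j)"
            by (rule lp_coord_le[OF p sub[OF mem mem]])
          also have "\<dots> < e"
            using M that by blast
          finally show ?thesis
            by simp
        qed
        then show ?thesis
          by blast
      qed
      then have "Cauchy (\<lambda>i. \<sigma> i n)"
        by (rule CauchyI)
      then show ?thesis
        by (rule Cauchy_convergent)
    qed
    then obtain l where l: "\<And>n. (\<lambda>i. \<sigma> i n) \<longlonglongrightarrow> l n"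
      unfolding convergent_def by metis
    have key: "\<exists>M. \<forall>i\<ge>M. \<sigma> i - l \<in> lp_space p \<and> lp_norm p (\<sigma> i - l) \<le> e" if e: "0 < e" for e
    proof -
      obtain M where M: "\<forall>i j. M \<le> i \<longrightarrow> M \<le> j \<longrightarrow> lp_norm p (\<sigma> i - \<sigma> j) < e"
        using cau[OF e] by blast
      have "(\<Sum>n<k. \<bar>(\<sigma> i - l) n\<bar> powr p) \<le> e powr p" if i: "M \<le> i" for i k
      proof (rule LIMSEQ_le_const2)
        show "(\<lambda>j. \<Sum>n<k. \<bar>(\<sigma> i - \<sigma> j) n\<bar> powr p) \<longlonglongrightarrow> (\<Sum>n<k. \<bar>(\<sigma> i - l) n\<bar> powr p)"
          unfolding fun_diff_def using p
          by (intro tendsto_sum tendsto_powr2 tendsto_rabs tendsto_diff tendsto_const l) auto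
        have "(\<Sum>n<k. \<bar>(\<sigma> i - \<sigma> j) n\<bar> powr p) \<le> e powr p" if "M \<le> j" for j
        proof -
          have "(\<Sum>n<k. \<bar>(\<sigma> i - \<sigma> j) n\<bar> powr p) \<le> lp_norm p (\<sigma> i - \<sigma> j) powr p"
            by (rule lp_partial_sum_le[OF p sub[OF mem mem]])
          also have "\<dots> \<le> e powr p"
            using M i that p by (intro powr_mono2) (auto intro: less_imp_le)
          finally show ?thesis .
        qed
        then show "\<exists>M. \<forall>j\<ge>M. (\<Sum>n<k. \<bar>(\<sigma> i - \<sigma> j) n\<bar> powr p) \<le> e powr p"
          by blast
      qed
      then show ?thesis
        using lp_norm_leI[OF p, of e] e by (meson less_imp_le)
    qed
    obtain i where "\<sigma> i - l \<in> lp_space p"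
      using key[of 1] by auto
    then have lmem: "l \<in> lp_space p"
      using sub[OF mem[of i]] by fastforce
    have "limitin mtopology \<sigma> l sequentially"
      unfolding limitin_metric eventually_sequentially
    proof (intro conjI allI impI lmem)
      fix e :: real assume "0 < e"
      then obtain M where "\<forall>i\<ge>M. lp_norm p (\<sigma> i - l) \<le> e / 2"
        using key[of "e / 2"] by auto
      then have "\<forall>i\<ge>M. lp_norm p (\<sigma> i - l) < e"
        using \<open>0 < e\<close> by fastforce
      then show "\<exists>M. \<forall>i\<ge>M. \<sigma> i \<in> lp_space p \<and> norm_metric (lp_norm p) (\<sigma> i) l < e"
        using mem by (auto simp: norm_metric_def)
    qed
    then show "\<exists>l. limitin mtopology \<sigma> l sequentially"
      by blast
  qed
qed

lemma real_banach_on_lp: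
  assumes "1 \<le> p"
  shows "real_banach_on (lp_space p) (lp_norm p)"
  unfolding real_banach_on_def
  by (intro conjI ballI allI subspace_lp_space lp_norm_nonneg lp_norm_eq_0 lp_scaleR(2)
      lp_minkowski(2) Metric_space_lp mcomplete_lp assms)

end

theory Submission
  imports Defs
begin

text \<open>
  Hadamard matrices separate boundedness on \<open>\<ell>\<^sub>p\<close> from delta-semidefiniteness. Let \<open>H\<close> be a
  symmetric Hadamard matrix of order \<open>N\<close>, so that \<open>H / sqrt N\<close> is an orthogonal involution.

  On the one hand, \<open>H\<close> is small as a bilinear form on the unit ball of \<open>\<ell>\<^sub>p\<close>: it is bounded by
  \<open>3 N powr (1/4 + p/8)\<close>, whose exponent is less than \<open>1/2\<close> because \<open>p < 2\<close>
  (\<open>hadamard_form_lp_bound\<close>). Interpolation between the bounds \<open>1\<close> on \<open>\<ell>\<^sub>1\<close> and \<open>sqrt N\<close> on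
  \<open>\<ell>\<^sub>2\<close> would give the sharp exponent \<open>1 - 1/p\<close>; truncating the two arguments is more elementary
  and already gives an exponent below \<open>1/2\<close>.

  On the other hand, suppose that a form with matrix \<open>c H\<close> on some vectors \<open>e\<^sub>i\<close> is the difference
  of two nonnegative forms. Their sum \<open>s\<close> dominates the absolute value of the form, hence its trace
  is at least the trace norm of \<open>c H\<close>, which is \<open>c N sqrt N\<close> (\<open>hadamard_majorant_bound\<close>). If the
  \<open>e\<^sub>i\<close> are unit vectors and \<open>s\<close> is bounded by \<open>C\<close> on the unit ball, then the trace is at most
  \<open>N C\<close>, and therefore \<open>C \<ge> c sqrt N\<close>.

  The counterexample places Hadamard matrices of order \<open>N = 2 ^ k\<close>, multiplied by \<open>N powr (- t)\<close>,
  on disjoint blocks of coordinates, where \<open>1/4 + p/8 < t < 1/2\<close>. The upper bounds on the blocks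
  are summable in \<open>k\<close>, so the sum is a continuous form (\<open>block_hadamard_form_continuous\<close>), while the
  lower bounds \<open>N powr (1/2 - t)\<close> for \<open>C\<close> are unbounded
  (\<open>block_hadamard_form_not_delta_semidefinite\<close>).
\<close>

section \<open>Symmetric Hadamard matrices\<close>

definition symmetric_hadamard :: "nat \<Rightarrow> (nat \<Rightarrow> nat \<Rightarrow> real) \<Rightarrow> bool"
  where "symmetric_hadamard N w \<longleftrightarrow>
    (\<forall>i<N. \<forall>j<N. \<bar>w i j\<bar> = 1 \<and> w i j = w j i) \<and>
    (\<forall>i<N. \<forall>j<N. (\<Sum>l<N. w i l * w j l) = (if i = j then real N else 0))"

lemma symmetric_hadamardD:
  assumes "symmetric_hadamard N w" "i < N" "j < N"
  shows "\<bar>w i j\<bar> = 1" "w i j = w j i"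
    "(\<Sum>l<N. w i l * w j l) = (if i = j then real N else 0)"
  using assms unfolding symmetric_hadamard_def by blast+

text \<open>
  Sylvester's construction, read off the binary digits of the indices: the entry is the parity sign
  of the number of positions, among the lowest \<open>k\<close>, at which both indices have the digit 1.
\<close>

fun sylvester :: "nat \<Rightarrow> nat \<Rightarrow> nat \<Rightarrow> real"
  where
    "sylvester 0 i j = 1"
  | "sylvester (Suc k) i j = (if odd i \<and> odd j then - 1 else 1) * sylvester k (i div 2) (j div 2)"

lemma abs_sylvester: "\<bar>sylvester k i j\<bar> = 1"
  by (induction k arbitrary: i j) auto

lemma sylvester_commute: "sylvester k i j = sylvester k j i"
  by (induction k arbitrary: i j) auto

lemma sum_even_odd:
  fixes f :: "nat \<Rightarrow> 'a::comm_monoid_add"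
  shows "(\<Sum>l<2 * n. f l) = (\<Sum>l<n. f (2 * l) + f (Suc (2 * l)))"
  by (induction n) (auto simp: add_ac)

text \<open>
  Splitting the sum by the last digit of \<open>l\<close>, the two terms agree if \<open>i\<close> and \<open>j\<close> have the same
  last digit and cancel otherwise; what remains is the sum for the shortened indices.
\<close>

lemma sylvester_orthogonal:
  "i < 2 ^ k \<Longrightarrow> j < 2 ^ k \<Longrightarrow>
    (\<Sum>l<2 ^ k. sylvester k i l * sylvester k j l) = (if i = j then 2 ^ k else 0)"
proof (induction k arbitrary: i j)
  case (Suc k)
  have div: "i div 2 < 2 ^ k" "j div 2 < 2 ^ k"
    using Suc.prems by auto
  have eq: "i = j \<longleftrightarrow> i div 2 = j div 2 \<and> (odd i \<longleftrightarrow> odd j)"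
    by (metis dvd_mult_div_cancel odd_two_times_div_two_succ)
  have "(\<Sum>l<2 ^ Suc k. sylvester (Suc k) i l * sylvester (Suc k) j l) =
      (\<Sum>l<2 ^ k. (if odd i = odd j then 2 else 0) *
        (sylvester k (i div 2) l * sylvester k (j div 2) l))"
    unfolding power_Suc sum_even_odd by (intro sum.cong) auto
  also have "\<dots> = (if i = j then 2 ^ Suc k else 0)"
    unfolding sum_distrib_left[symmetric] Suc.IH[OF div] using eq by auto
  finally show ?case .
qed auto

lemma symmetric_hadamard_sylvester: "symmetric_hadamard (2 ^ k) (sylvester k)"
  using abs_sylvester sylvester_commute sylvester_orthogonal
  by (auto simp: symmetric_hadamard_def)

definition matrix_form :: "nat \<Rightarrow> (nat \<Rightarrow> nat \<Rightarrow> real) \<Rightarrow> (nat \<Rightarrow> real) \<Rightarrow> (nat \<Rightarrow> real) \<Rightarrow> real"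
  where "matrix_form N w x y = (\<Sum>i<N. \<Sum>j<N. w i j * x i * y j)"

lemma matrix_form_add:
  "matrix_form N w (\<lambda>i. x i + x' i) y = matrix_form N w x y + matrix_form N w x' y"
  "matrix_form N w x (\<lambda>i. y i + y' i) = matrix_form N w x y + matrix_form N w x y'"
  by (simp_all add: matrix_form_def sum.distrib algebra_simps)

lemma matrix_form_scale:
  "matrix_form N w (\<lambda>i. c * x i) y = c * matrix_form N w x y"
  "matrix_form N w x (\<lambda>i. c * y i) = c * matrix_form N w x y"
  by (simp_all add: matrix_form_def sum_distrib_left mult_ac)

lemma hadamard_form_l1_bound:
  assumes "symmetric_hadamard N w"
  shows "\<bar>matrix_form N w x y\<bar> \<le> (\<Sum>i<N. \<bar>x i\<bar>) * (\<Sum>i<N. \<bar>y i\<bar>)"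
proof -
  have "\<bar>matrix_form N w x y\<bar> \<le> (\<Sum>i<N. \<Sum>j<N. \<bar>w i j * x i * y j\<bar>)"
    unfolding matrix_form_def by (intro order.trans[OF sum_abs] sum_mono sum_abs)
  also have "\<dots> = (\<Sum>i<N. \<Sum>j<N. \<bar>x i\<bar> * \<bar>y j\<bar>)"
    using assms by (intro sum.cong) (auto simp: symmetric_hadamard_def abs_mult)
  finally show ?thesis
    by (simp add: sum_product)
qed

text \<open>
  For a bilinear form with matrix \<open>g\<close>, this computes its trace along the rows of \<open>w\<close>: these rows
  are \<open>sqrt N\<close> times an orthonormal basis, and the trace does not depend on the basis.
\<close>

lemma sum_hadamard_rows:
  fixes g :: "nat \<Rightarrow> nat \<Rightarrow> real"
  assumes w: "symmetric_hadamard N w"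
  shows "(\<Sum>i<N. \<Sum>j<N. \<Sum>l<N. w i j * w i l * g j l) = N * (\<Sum>j<N. g j j)"
proof -
  have orth: "(\<Sum>i<N. w i j * w i l) = (if j = l then real N else 0)" if "j < N" "l < N" for j l
  proof -
    have "(\<Sum>i<N. w i j * w i l) = (\<Sum>i<N. w j i * w l i)"
      using w that by (intro sum.cong) (auto simp: symmetric_hadamard_def)
    also have "\<dots> = (if j = l then real N else 0)"
      by (rule symmetric_hadamardD(3)[OF w that])
    finally show ?thesis .
  qed
  have "(\<Sum>i<N. \<Sum>j<N. \<Sum>l<N. w i j * w i l * g j l) =
      (\<Sum>j<N. \<Sum>i<N. \<Sum>l<N. w i j * w i l * g j l)"
    by (rule sum.swap)
  also have "\<dots> = (\<Sum>j<N. \<Sum>l<N. \<Sum>i<N. w i j * w i l * g j l)"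
    by (intro sum.cong refl sum.swap)
  also have "\<dots> = (\<Sum>j<N. \<Sum>l<N. (\<Sum>i<N. w i j * w i l) * g j l)"
    unfolding sum_distrib_right ..
  also have "\<dots> = (\<Sum>j<N. \<Sum>l<N. if j = l then N * g j l else 0)"
    by (intro sum.cong) (auto simp: orth)
  finally show ?thesis
    by (simp add: sum_distrib_left)
qed

lemma hadamard_form_l2_bound:
  assumes w: "symmetric_hadamard N w"
  shows "\<bar>matrix_form N w x y\<bar> \<le> sqrt N * L2_set x {..<N} * L2_set y {..<N}"
proof -
  define z where "z i = (\<Sum>j<N. w i j * y j)" for i
  have "(\<Sum>i<N. (z i)\<^sup>2) = (\<Sum>i<N. \<Sum>j<N. \<Sum>l<N. w i j * w i l * (y j * y l))"
    by (simp add: z_def power2_eq_square sum_product mult_ac)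
  also have "\<dots> = N * (\<Sum>j<N. (y j)\<^sup>2)"
    using sum_hadamard_rows[OF w, of "\<lambda>j l. y j * y l"] by (simp add: power2_eq_square)
  finally have z: "L2_set z {..<N} = sqrt N * L2_set y {..<N}"
    by (simp add: L2_set_def real_sqrt_mult)
  have "matrix_form N w x y = (\<Sum>i<N. x i * z i)"
    by (simp add: matrix_form_def z_def sum_distrib_left mult_ac)
  then have "\<bar>matrix_form N w x y\<bar> \<le> (\<Sum>i<N. \<bar>x i\<bar> * \<bar>z i\<bar>)"
    using sum_abs[of "\<lambda>i. x i * z i"] by (simp add: abs_mult)
  also have "\<dots> \<le> L2_set x {..<N} * L2_set z {..<N}"
    by (rule L2_set_mult_ineq)
  finally show ?thesis
    by (simp add: z mult_ac)
qed

section \<open>Hadamard forms on the unit ball of \<open>\<ell>\<^sub>p\<close>\<close>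

text \<open>
  Cutting at height \<open>t\<close>, the few large coordinates (\<open>x'\<close>) are controlled in \<open>\<ell>\<^sub>1\<close> and the small
  ones (\<open>x''\<close>) gain a power of \<open>t\<close> in \<open>\<ell>\<^sub>2\<close>, because \<open>\<bar>a\<bar> powr r\<close> equals
  \<open>\<bar>a\<bar> powr (r - p) * \<bar>a\<bar> powr p\<close> and the exponent \<open>r - p\<close> is nonpositive for \<open>r = 1\<close> and positive
  for \<open>r = 2\<close>.
\<close>

lemma truncation_bounds:
  fixes x :: "nat \<Rightarrow> real" and p t :: real
  assumes p: "1 \<le> p" "p < 2" and t: "0 < t"
    and ball: "(\<Sum>i<N. \<bar>x i\<bar> powr p) \<le> 1"
  obtains x' x'' where "\<And>i. x i = x' i + x'' i"
    and "(\<Sum>i<N. \<bar>x' i\<bar>) \<le> t powr (1 - p)"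
    and "L2_set x' {..<N} \<le> 1" and "L2_set x {..<N} \<le> 1"
    and "L2_set x'' {..<N} \<le> t powr (1 - p / 2)"
proof
  define x' where "x' i = (if \<bar>x i\<bar> > t then x i else 0)" for i
  define x'' where "x'' i = (if \<bar>x i\<bar> > t then 0 else x i)" for i
  show "x i = x' i + x'' i" for i
    by (simp add: x'_def x''_def)
  have split: "\<bar>a\<bar> powr (r + p) = \<bar>a\<bar> powr r * \<bar>a\<bar> powr p" for a r :: real
    by (rule powr_add)
  have le1: "\<bar>x i\<bar> \<le> 1" if "i < N" for i
  proof -
    have "\<bar>x i\<bar> powr p \<le> (\<Sum>i<N. \<bar>x i\<bar> powr p)"
      using that by (intro member_le_sum) auto
    then have "\<bar>x i\<bar> powr p \<le> 1 powr p"
      using ball by simp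
    moreover have "1 powr p < \<bar>x i\<bar> powr p" if "1 < \<bar>x i\<bar>"
      using p that by (intro powr_less_mono2) auto
    ultimately show ?thesis
      by linarith
  qed
  have "\<bar>x' i\<bar> \<le> t powr (1 - p) * \<bar>x i\<bar> powr p" for i
  proof (cases "\<bar>x i\<bar> > t")
    case True
    have "\<bar>x i\<bar> = \<bar>x i\<bar> powr (1 - p) * \<bar>x i\<bar> powr p"
      using split[of "x i" "1 - p"] by simp
    also have "\<dots> \<le> t powr (1 - p) * \<bar>x i\<bar> powr p"
      using True t p by (intro mult_right_mono powr_mono2') auto
    finally show ?thesis
      using True by (simp add: x'_def)
  qed (simp add: x'_def)
  then have "(\<Sum>i<N. \<bar>x' i\<bar>) \<le> t powr (1 - p) * (\<Sum>i<N. \<bar>x i\<bar> powr p)"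
    unfolding sum_distrib_left by (intro sum_mono)
  also have "\<dots> \<le> t powr (1 - p) * 1"
    by (intro mult_left_mono ball) auto
  finally show "(\<Sum>i<N. \<bar>x' i\<bar>) \<le> t powr (1 - p)"
    by simp
  have sq: "a\<^sup>2 = \<bar>a\<bar> powr (2 - p) * \<bar>a\<bar> powr p" for a :: real
    using split[of a "2 - p"] by (simp add: powr_numeral)
  have "(x i)\<^sup>2 \<le> \<bar>x i\<bar> powr p" if "i < N" for i
  proof -
    have "\<bar>x i\<bar> powr (2 - p) \<le> 1 powr (2 - p)"
      using p le1[OF that] by (intro powr_mono2) auto
    then show ?thesis
      unfolding sq[of "x i"] by (simp add: mult_left_le_one_le)
  qed
  then have "(\<Sum>i<N. (x i)\<^sup>2) \<le> (\<Sum>i<N. \<bar>x i\<bar> powr p)"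
    by (intro sum_mono) auto
  then show x2: "L2_set x {..<N} \<le> 1"
    using ball by (simp add: L2_set_def)
  have "L2_set x' {..<N} \<le> L2_set x {..<N}"
    unfolding L2_set_def by (intro real_sqrt_le_mono sum_mono) (auto simp: x'_def)
  with x2 show "L2_set x' {..<N} \<le> 1"
    by simp
  have "(x'' i)\<^sup>2 \<le> t powr (2 - p) * \<bar>x i\<bar> powr p" for i
  proof (cases "\<bar>x i\<bar> > t")
    case False
    then show ?thesis
      using t p unfolding x''_def
      by (simp add: sq[of "x i"] mult_right_mono powr_mono2)
  qed (simp add: x''_def)
  then have "(\<Sum>i<N. (x'' i)\<^sup>2) \<le> t powr (2 - p) * (\<Sum>i<N. \<bar>x i\<bar> powr p)"
    unfolding sum_distrib_left by (intro sum_mono)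
  also have "\<dots> \<le> t powr (2 - p) * 1"
    by (intro mult_left_mono ball) auto
  also have "\<dots> = (t powr (1 - p / 2))\<^sup>2"
    using t by (simp add: powr_power)
  finally show "L2_set x'' {..<N} \<le> t powr (1 - p / 2)"
    unfolding L2_set_def by (simp add: real_le_lsqrt)
qed

text \<open>
  Only the product of the two large parts is estimated by the \<open>\<ell>\<^sub>1\<close> bound; every product with a small
  part uses the \<open>\<ell>\<^sub>2\<close> bound, where the factor \<open>sqrt N\<close> is reduced by the truncation.
\<close>

lemma hadamard_form_lp_bound:
  fixes p :: real
  assumes w: "symmetric_hadamard N w" and N: "1 \<le> N" and p: "1 \<le> p" "p < 2"
    and x: "(\<Sum>i<N. \<bar>x i\<bar> powr p) \<le> 1" and y: "(\<Sum>i<N. \<bar>y i\<bar> powr p) \<le> 1"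
  shows "\<bar>matrix_form N w x y\<bar> \<le> 3 * N powr (1/4 + p/8)"
proof -
  \<comment> \<open>Any sufficiently small negative power of \<open>N\<close> keeps both exponents below \<open>1/2\<close>. With this one
    they are \<open>(p - 1) / 2\<close> for the large parts and \<open>1/4 + p/8\<close> for the others.\<close>
  define t where "t = N powr (- 1/4)"
  have t: "0 < t"
    using N by (simp add: t_def)
  obtain x' x'' where x_split: "\<And>i. x i = x' i + x'' i"
    and x': "(\<Sum>i<N. \<bar>x' i\<bar>) \<le> t powr (1 - p)" "L2_set x' {..<N} \<le> 1"
    and x'': "L2_set x'' {..<N} \<le> t powr (1 - p / 2)"
    using truncation_bounds[OF p t x] by metis
  obtain y' y'' where y_split: "\<And>i. y i = y' i + y'' i"
    and y': "(\<Sum>i<N. \<bar>y' i\<bar>) \<le> t powr (1 - p)"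
    and y2: "L2_set y {..<N} \<le> 1"
    and y'': "L2_set y'' {..<N} \<le> t powr (1 - p / 2)"
    using truncation_bounds[OF p t y] by metis
  have "matrix_form N w x y = matrix_form N w (\<lambda>i. x' i + x'' i) y"
    by (simp flip: x_split)
  also have "\<dots> = matrix_form N w x' (\<lambda>i. y' i + y'' i) + matrix_form N w x'' y"
    by (simp add: matrix_form_add(1) flip: y_split)
  also have "\<dots> = matrix_form N w x' y' + matrix_form N w x' y'' + matrix_form N w x'' y"
    by (simp add: matrix_form_add(2))
  finally have split: "matrix_form N w x y = \<dots>" .
  have "\<bar>matrix_form N w x' y'\<bar> \<le> t powr (1 - p) * t powr (1 - p)"
    using x' y' by (intro order.trans[OF hadamard_form_l1_bound[OF w]] mult_mono) (auto intro: sum_nonneg)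
  also have "\<dots> = N powr ((p - 1) / 2)"
    by (simp add: t_def powr_powr flip: powr_add) (simp add: minus_divide_left)
  also have "\<dots> \<le> N powr (1/4 + p/8)"
    using N p by (intro powr_mono) auto
  finally have b1: "\<bar>matrix_form N w x' y'\<bar> \<le> N powr (1/4 + p/8)" .
  have eq: "sqrt N * t powr (1 - p / 2) = N powr (1/4 + p/8)"
    by (simp add: t_def powr_powr flip: powr_half_sqrt powr_add) (simp add: field_simps)
  have "\<bar>matrix_form N w x' y''\<bar> \<le> sqrt N * 1 * t powr (1 - p / 2)"
    using x' y'' by (intro order.trans[OF hadamard_form_l2_bound[OF w]] mult_mono) auto
  then have b2: "\<bar>matrix_form N w x' y''\<bar> \<le> N powr (1/4 + p/8)"
    using eq by simp
  have "\<bar>matrix_form N w x'' y\<bar> \<le> sqrt N * t powr (1 - p / 2) * 1"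
    using x'' y2 by (intro order.trans[OF hadamard_form_l2_bound[OF w]] mult_mono) auto
  then have b3: "\<bar>matrix_form N w x'' y\<bar> \<le> N powr (1/4 + p/8)"
    using eq by simp
  show ?thesis
    using b1 b2 b3 unfolding split by linarith
qed

section \<open>Bilinear forms on a normed space\<close>

lemma bilinear_on_add:
  assumes "bilinear_on X b" "x \<in> X" "y \<in> X" "z \<in> X"
  shows "b (x + y) z = b x z + b y z" "b z (x + y) = b z x + b z y"
  using assms unfolding bilinear_on_def by blast+

lemma bilinear_on_scale:
  assumes "bilinear_on X b" "x \<in> X" "y \<in> X"
  shows "b (c *\<^sub>R x) y = c * b x y" "b x (c *\<^sub>R y) = c * b x y"
  using assms unfolding bilinear_on_def by blast+

lemma bilinear_on_sum_left:
  assumes "bilinear_on X b" "subspace X" "finite S" "\<And>i. i \<in> S \<Longrightarrow> e i \<in> X" "y \<in> X"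
  shows "b (\<Sum>i\<in>S. c i *\<^sub>R e i) y = (\<Sum>i\<in>S. c i * b (e i) y)"
  using assms(3,4)
proof (induction S)
  case empty
  have "b (0 *\<^sub>R 0) y = 0 * b 0 y"
    by (rule bilinear_on_scale(1)[OF assms(1) subspace_0[OF assms(2)] assms(5)])
  then show ?case
    by simp
next
  case (insert i S)
  have "c i *\<^sub>R e i \<in> X" "(\<Sum>i\<in>S. c i *\<^sub>R e i) \<in> X"
    using insert.prems assms(2) by (auto intro!: subspace_sum subspace_scale)
  then show ?case
    using insert by (simp add: bilinear_on_add[OF assms(1)] bilinear_on_scale[OF assms(1)] assms(5))
qed

lemma bilinear_on_flip: "bilinear_on X b \<Longrightarrow> bilinear_on X (\<lambda>x y. b y x)"
  by (simp add: bilinear_on_def)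

lemma bilinear_on_sum:
  assumes b: "bilinear_on X b" and X: "subspace X" and S: "finite S" and e: "\<And>i. i \<in> S \<Longrightarrow> e i \<in> X"
  shows "b (\<Sum>i\<in>S. c i *\<^sub>R e i) (\<Sum>j\<in>S. d j *\<^sub>R e j) = (\<Sum>i\<in>S. \<Sum>j\<in>S. c i * d j * b (e i) (e j))"
proof -
  have "(\<Sum>j\<in>S. d j *\<^sub>R e j) \<in> X"
    using X e by (auto intro!: subspace_sum subspace_scale)
  then show ?thesis
    using bilinear_on_sum_left[OF b X S e] bilinear_on_sum_left[OF bilinear_on_flip[OF b] X S e] e
    by (simp add: sum_distrib_left mult_ac)
qed

lemma bounded_bilinear_form_continuous:
  assumes B: "real_banach_on X N" and b: "bilinear_on X b"
    and bound: "\<And>x y. x \<in> X \<Longrightarrow> y \<in> X \<Longrightarrow> \<bar>b x y\<bar> \<le> C * (N x * N y)"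
  shows "continuous_bilinear_form X N b"
proof -
  interpret Metric_space X "norm_metric N"
    using B by (simp add: real_banach_on_def)
  have X: "subspace X"
    using B by (simp add: real_banach_on_def)
  let ?T = "prod_topology mtopology mtopology"
  have "limitin euclideanreal (\<lambda>(x, y). b x y) (b x y) (atin ?T (x, y))"
    if xy: "x \<in> X" "y \<in> X" for x y
  proof -
    have dist: "continuous_map mtopology euclideanreal (\<lambda>u. norm_metric N u z)" if "z \<in> X" for z
      using continuous_map_mdist[of mtopology Self "\<lambda>u. u" "\<lambda>u. z"] that
      by (simp add: mtopology_of_def)
    have "continuous_map ?T euclideanreal (\<lambda>u. norm_metric N (fst u) x)"
      "continuous_map ?T euclideanreal (\<lambda>u. norm_metric N (snd u) y)"
      using continuous_map_compose[OF continuous_map_fst dist[OF xy(1)], of mtopology]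
        continuous_map_compose[OF continuous_map_snd dist[OF xy(2)], of mtopology]
      by (simp_all add: o_def)
    moreover have "norm_metric N x x = 0" "norm_metric N y y = 0"
      using xy zero by auto
    ultimately have lim: "((\<lambda>u. norm_metric N (fst u) x) \<longlongrightarrow> 0) (atin ?T (x, y))"
      "((\<lambda>u. norm_metric N (snd u) y) \<longlongrightarrow> 0) (atin ?T (x, y))"
      using xy by (fastforce simp: continuous_map_atin)+
    let ?g = "\<lambda>u. C * (norm_metric N (fst u) x * norm_metric N (snd u) y) +
      C * (N x * norm_metric N (snd u) y) + C * (norm_metric N (fst u) x * N y)"
    \<comment> \<open>Expanding \<open>b\<close> at \<open>(x + u, y + v)\<close> bounds its increment by \<open>?g\<close>.\<close>
    have "(?g \<longlongrightarrow> C * (0 * 0) + C * (N x * 0) + C * (0 * N y)) (atin ?T (x, y))"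
      by (intro tendsto_intros lim)
    then have g: "(?g \<longlongrightarrow> 0) (atin ?T (x, y))"
      by simp
    have "\<forall>\<^sub>F u in atin ?T (x, y). u \<in> X \<times> X"
      unfolding eventually_atin using xy by (auto intro!: exI[of _ "X \<times> X"] simp: openin_prod_Times_iff)
    then have "\<forall>\<^sub>F u in atin ?T (x, y). norm ((case u of (x, y) \<Rightarrow> b x y) - b x y) \<le> ?g u"
    proof (rule eventually_mono, clarify)
      fix x' y' assume mem: "x' \<in> X" "y' \<in> X"
      have d: "x' - x \<in> X" "y' - y \<in> X"
        using X xy mem by (auto intro: subspace_diff)
      have "b (x + u) (y + v) = b x y + (b u v + b x v + b u y)"
        if uv: "u \<in> X" "v \<in> X" for u v
        by (simp add: bilinear_on_add[OF b] xy uv subspace_add[OF X])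
      note this[OF d]
      then have "b x' y' - b x y = b (x' - x) (y' - y) + b x (y' - y) + b (x' - x) y"
        by simp
      also have "norm \<dots> \<le> C * (N (x' - x) * N (y' - y)) + C * (N x * N (y' - y)) + C * (N (x' - x) * N y)"
        using bound[OF d] bound[OF xy(1) d(2)] bound[OF d(1) xy(2)] by simp
      finally show "norm (b x' y' - b x y) \<le> ?g (x', y')"
        by (simp add: norm_metric_def)
    qed
    then have "((\<lambda>u. (case u of (x, y) \<Rightarrow> b x y) - b x y) \<longlongrightarrow> 0) (atin ?T (x, y))"
      using g by (rule Lim_null_comparison)
    then show ?thesis
      by (simp add: Lim_null[symmetric])
  qed
  then have "continuous_map ?T euclideanreal (\<lambda>(x, y). b x y)"
    by (auto simp: continuous_map_atin)
  with b show ?thesis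
    by (simp add: continuous_bilinear_form_def norm_topology_def)
qed

lemma continuous_bilinear_form_bound:
  assumes B: "real_banach_on X N" and b: "continuous_bilinear_form X N b"
  obtains C where "\<And>x. x \<in> X \<Longrightarrow> N x \<le> 1 \<Longrightarrow> b x x \<le> C"
proof -
  interpret Metric_space X "norm_metric N"
    using B by (simp add: real_banach_on_def)
  have X: "subspace X" and bil: "bilinear_on X b"
    using B b by (simp_all add: real_banach_on_def continuous_bilinear_form_def)
  have zero: "0 \<in> X"
    using X by (rule subspace_0)
  have "b (0 *\<^sub>R 0) 0 = 0 * b 0 0"
    by (rule bilinear_on_scale(1)[OF bil zero zero])
  then have b0: "b 0 0 = 0"
    by simp
  let ?T = "prod_topology mtopology mtopology"
  have "continuous_map ?T euclideanreal (\<lambda>(x, y). b x y)"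
    using b by (simp add: continuous_bilinear_form_def norm_topology_def)
  then have "openin ?T {z \<in> topspace ?T. (\<lambda>(x, y). b x y) z \<in> {..<1}}"
    by (rule openin_continuous_map_preimage) auto
  moreover have "(0, 0) \<in> {z \<in> topspace ?T. (\<lambda>(x, y). b x y) z \<in> {..<1}}"
    using zero b0 by simp
  ultimately obtain U V where UV: "openin mtopology U" "openin mtopology V" "0 \<in> U" "0 \<in> V"
    and le: "U \<times> V \<subseteq> {z \<in> topspace ?T. (\<lambda>(x, y). b x y) z \<in> {..<1}}"
    unfolding openin_prod_topology_alt by meson
  have "openin mtopology (U \<inter> V)" "0 \<in> U \<inter> V"
    using UV by auto
  then obtain r where r: "0 < r" "mball 0 r \<subseteq> U \<inter> V"
    unfolding openin_mtopology by blast
  have "b x x \<le> 4 / r\<^sup>2" if x: "x \<in> X" "N x \<le> 1" for x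
  proof -
    let ?x = "(r / 2) *\<^sub>R x"
    have N: "N (c *\<^sub>R x) = \<bar>c\<bar> * N x" for c
      using B x(1) unfolding real_banach_on_def by blast
    have "N ?x \<le> r / 2"
      using x(2) r(1) by (simp add: N)
    moreover have mem: "- ?x \<in> X" "?x \<in> X"
      using X x(1) by (auto intro: subspace_scale subspace_neg)
    moreover have "N (- ?x) = N ?x"
      using N[of "- (r / 2)"] N[of "r / 2"] by simp
    ultimately have "?x \<in> mball 0 r"
      using r(1) zero by (simp add: norm_metric_def)
    then have "(?x, ?x) \<in> U \<times> V"
      using r(2) by blast
    then have "b ?x ?x < 1"
      using le by auto
    moreover have "b ?x ?x = (r / 2) * ((r / 2) * b x x)"
      by (simp only: bilinear_on_scale[OF bil] x(1) mem(2))
    ultimately show ?thesis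
      using r(1) by (simp add: field_simps power2_eq_square)
  qed
  then show thesis
    by (rule that)
qed

section \<open>Trace of a majorant of a Hadamard form\<close>

text \<open>
  With \<open>f\<^sub>i\<close> the combination of the \<open>e\<^sub>j\<close> along row \<open>i\<close>, the vectors \<open>sqrt N e\<^sub>i \<plusminus> f\<^sub>i\<close> represent
  eigenvectors of the Hadamard matrix for the eigenvalues \<open>\<plusminus> sqrt N\<close>. Using \<open>s \<ge> b\<close> at the plus sign
  and \<open>s \<ge> - b\<close> at the minus sign makes the two contributions of \<open>b\<close> add up, while the mixed terms
  of \<open>s\<close> cancel. Summed over \<open>i\<close>, the values of \<open>s\<close> at the \<open>f\<^sub>i\<close> give \<open>N\<close> times the trace again.
\<close>

lemma hadamard_majorant_bound:
  assumes X: "subspace X" and b: "bilinear_on X b" and s: "bilinear_on X s"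
    and major: "\<And>x. x \<in> X \<Longrightarrow> \<bar>b x x\<bar> \<le> s x x"
    and w: "symmetric_hadamard N w" and e: "\<And>i. i < N \<Longrightarrow> e i \<in> X"
    and entries: "\<And>i j. i < N \<Longrightarrow> j < N \<Longrightarrow> b (e i) (e j) = c * w i j"
    and N: "0 < N"
  shows "c * N * sqrt N \<le> (\<Sum>i<N. s (e i) (e i))"
proof -
  define f where "f i = (\<Sum>j<N. w i j *\<^sub>R e j)" for i
  have f: "f i \<in> X" for i
    unfolding f_def using X e by (auto intro!: subspace_sum subspace_scale)
  have expand: "g (a *\<^sub>R x + d *\<^sub>R y) (a *\<^sub>R x + d *\<^sub>R y) =
      a\<^sup>2 * g x x + a * d * (g x y + g y x) + d\<^sup>2 * g y y"
    if g: "bilinear_on X g" and xy: "x \<in> X" "y \<in> X" for g x y a d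
  proof -
    have m: "a *\<^sub>R x \<in> X" "d *\<^sub>R y \<in> X" "a *\<^sub>R x + d *\<^sub>R y \<in> X"
      using X xy by (auto intro: subspace_add subspace_scale)
    show ?thesis
      by (simp add: bilinear_on_add[OF g] bilinear_on_scale[OF g] m xy power2_eq_square algebra_simps)
  qed
  \<comment> \<open>Half the sum of the two majorant inequalities at \<open>sqrt N e\<^sub>i \<plusminus> f\<^sub>i\<close>.\<close>
  have row: "2 * c * N * sqrt N \<le> N * s (e i) (e i) + s (f i) (f i)" if i: "i < N" for i
  proof -
    have sqw: "(\<Sum>j<N. w i j * w i j) = N"
      using symmetric_hadamardD(3)[OF w i i] by simp
    have "b (f i) (e i) = (\<Sum>j<N. w i j * b (e j) (e i))"
      unfolding f_def using i e by (intro bilinear_on_sum_left[OF b X]) auto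
    also have "\<dots> = (\<Sum>j<N. c * (w i j * w i j))"
      using i w by (intro sum.cong) (auto simp: entries symmetric_hadamard_def)
    finally have fe: "b (f i) (e i) = c * N"
      by (simp add: sqw flip: sum_distrib_left)
    have "b (e i) (f i) = (\<Sum>j<N. w i j * b (e i) (e j))"
      unfolding f_def using i e by (intro bilinear_on_sum_left[OF bilinear_on_flip[OF b] X]) auto
    also have "\<dots> = (\<Sum>j<N. c * (w i j * w i j))"
      using i by (intro sum.cong) (auto simp: entries)
    finally have ef: "b (e i) (f i) = c * N"
      by (simp add: sqw flip: sum_distrib_left)
    let ?r = "sqrt N"
    have m: "?r *\<^sub>R e i + d *\<^sub>R f i \<in> X" for d
      using X e[OF i] f by (auto intro: subspace_add subspace_scale)
    have "4 * c * N * ?r \<le> 2 * N * s (e i) (e i) + 2 * s (f i) (f i)"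
      using major[OF m[of 1]] major[OF m[of "- 1"]]
      unfolding expand[OF b e[OF i] f] expand[OF s e[OF i] f] ef fe
      by (simp add: algebra_simps)
    then show ?thesis
      by simp
  qed
  have "(\<Sum>i<N. s (f i) (f i)) = (\<Sum>i<N. \<Sum>j<N. \<Sum>l<N. w i j * w i l * s (e j) (e l))"
    unfolding f_def using e by (intro sum.cong bilinear_on_sum[OF s X]) auto
  also have "\<dots> = N * (\<Sum>j<N. s (e j) (e j))"
    by (rule sum_hadamard_rows[OF w])
  finally have sf: "(\<Sum>i<N. s (f i) (f i)) = N * (\<Sum>j<N. s (e j) (e j))" .
  have "N * (2 * c * N * sqrt N) = (\<Sum>i<N. 2 * c * N * sqrt N)"
    by simp
  also have "\<dots> \<le> (\<Sum>i<N. N * s (e i) (e i) + s (f i) (f i))"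
    by (intro sum_mono row) auto
  also have "\<dots> = N * (2 * (\<Sum>j<N. s (e j) (e j)))"
    by (simp add: sum.distrib sf flip: sum_distrib_left)
  finally have "2 * c * N * sqrt N \<le> 2 * (\<Sum>j<N. s (e j) (e j))"
    using N by (simp add: mult_le_cancel_left_pos)
  then show ?thesis
    by simp
qed

section \<open>Hadamard forms on disjoint blocks of coordinates\<close>

definition unit_vec :: "nat \<Rightarrow> nat \<Rightarrow> real"
  where "unit_vec n = (\<lambda>m. if m = n then 1 else 0)"

lemma unit_vec_lp:
  assumes "1 \<le> p"
  shows "unit_vec n \<in> lp_space p" "lp_norm p (unit_vec n) \<le> 1"
proof -
  have "(\<Sum>m<k. \<bar>unit_vec n m\<bar> powr p) = (\<Sum>m<k. if m = n then 1 else 0)" for k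
    by (intro sum.cong) (auto simp: unit_vec_def)
  then have "(\<Sum>m<k. \<bar>unit_vec n m\<bar> powr p) \<le> 1 powr p" for k
    by simp
  then show "unit_vec n \<in> lp_space p" "lp_norm p (unit_vec n) \<le> 1"
    using lp_norm_leI[OF assms, of 1] by auto
qed

text \<open>
  Block \<open>k\<close> starts at coordinate \<open>2 ^ k\<close>; its first \<open>2 ^ k\<close> coordinates end just before block
  \<open>k + 1\<close>. Later ones are part of the sequence but are never read by \<open>sylvester_form k\<close>.
\<close>

definition dyadic_block :: "nat \<Rightarrow> (nat \<Rightarrow> real) \<Rightarrow> nat \<Rightarrow> real"
  where "dyadic_block k x i = x (2 ^ k + i)"

lemma sum_dyadic_block_le:
  assumes "1 \<le> p" "x \<in> lp_space p"
  shows "(\<Sum>i<n. \<bar>dyadic_block k x i\<bar> powr p) \<le> lp_norm p x powr p"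
proof -
  have "(\<Sum>i<n. \<bar>dyadic_block k x i\<bar> powr p) = (\<Sum>m\<in>(+) (2 ^ k) ` {..<n}. \<bar>x m\<bar> powr p)"
    by (subst sum.reindex) (auto simp: dyadic_block_def)
  also have "\<dots> \<le> (\<Sum>m<2 ^ k + n. \<bar>x m\<bar> powr p)"
    by (intro sum_mono2) auto
  also have "\<dots> \<le> lp_norm p x powr p"
    by (rule lp_partial_sum_le[OF assms])
  finally show ?thesis .
qed

definition sylvester_form :: "nat \<Rightarrow> (nat \<Rightarrow> real) \<Rightarrow> (nat \<Rightarrow> real) \<Rightarrow> real"
  where "sylvester_form k x y = matrix_form (2 ^ k) (sylvester k) (dyadic_block k x) (dyadic_block k y)"

lemma sylvester_form_bilinear: "bilinear_on X (sylvester_form k)"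
proof -
  have "dyadic_block k (x + y) = (\<lambda>i. dyadic_block k x i + dyadic_block k y i)"
    and "dyadic_block k (c *\<^sub>R x) = (\<lambda>i. c * dyadic_block k x i)" for x y c
    by (simp_all add: dyadic_block_def scaleR_fun_def fun_eq_iff)
  then show ?thesis
    by (simp add: bilinear_on_def sylvester_form_def matrix_form_add matrix_form_scale)
qed

text \<open>Homogeneity carries the bound from the unit ball to the whole space.\<close>

lemma sylvester_form_bound:
  assumes p: "1 \<le> p" "p < 2" and x: "x \<in> lp_space p" and y: "y \<in> lp_space p"
  shows "\<bar>sylvester_form k x y\<bar> \<le> 3 * 2 powr (k * (1/4 + p/8)) * (lp_norm p x * lp_norm p y)"
proof (cases "lp_norm p x = 0 \<or> lp_norm p y = 0")
  case True
  then have "x = 0 \<or> y = 0"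
    using lp_norm_eq_0[OF p(1)] x y by blast
  then show ?thesis
    by (auto simp: sylvester_form_def matrix_form_def dyadic_block_def)
next
  case False
  define u where "u z i = dyadic_block k z i / lp_norm p z" for z :: "nat \<Rightarrow> real" and i
  have pos: "0 < lp_norm p x" "0 < lp_norm p y"
    using False lp_norm_nonneg[of p x] lp_norm_nonneg[of p y] by linarith+
  have unit: "(\<Sum>i<2 ^ k. \<bar>u z i\<bar> powr p) \<le> 1" if "z \<in> lp_space p" "0 < lp_norm p z" for z
    using sum_dyadic_block_le[OF p(1) that(1), of k "2 ^ k"] that(2)
    by (simp add: u_def powr_divide flip: sum_divide_distrib)
  have "\<bar>matrix_form (2 ^ k) (sylvester k) (u x) (u y)\<bar> \<le> 3 * real (2 ^ k) powr (1/4 + p/8)"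
    by (rule hadamard_form_lp_bound[OF symmetric_hadamard_sylvester _ p unit[OF x pos(1)] unit[OF y pos(2)]]) simp
  also have "real (2 ^ k) powr (1/4 + p/8) = 2 powr (k * (1/4 + p/8))"
    by (simp add: powr_powr flip: powr_realpow)
  finally have le: "\<bar>matrix_form (2 ^ k) (sylvester k) (u x) (u y)\<bar> \<le> 3 * 2 powr (k * (1/4 + p/8))" .
  have "dyadic_block k x = (\<lambda>i. lp_norm p x * u x i)" "dyadic_block k y = (\<lambda>i. lp_norm p y * u y i)"
    using pos by (auto simp: u_def)
  then have "sylvester_form k x y = matrix_form (2 ^ k) (sylvester k) (u x) (u y) * (lp_norm p x * lp_norm p y)"
    unfolding sylvester_form_def by (simp only: matrix_form_scale mult_ac)
  then show ?thesis
    using mult_right_mono[OF le, of "lp_norm p x * lp_norm p y"] pos by (simp add: abs_mult)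
qed

lemma sylvester_form_unit_vec:
  assumes "i < 2 ^ k" "j < 2 ^ k"
  shows "sylvester_form l (unit_vec (2 ^ k + i)) (unit_vec (2 ^ k + j)) = (if l = k then sylvester k i j else 0)"
proof (cases "l = k")
  case True
  have "dyadic_block k (unit_vec (2 ^ k + i)) = (\<lambda>m. if m = i then 1 else 0)" for i
    by (auto simp: dyadic_block_def unit_vec_def)
  then show ?thesis
    using assms True by (simp add: sylvester_form_def matrix_form_def if_distrib[of "(*) _"] cong: if_cong)
next
  case False
  have "2 ^ l + m \<noteq> 2 ^ k + i" if "m < 2 ^ l" for m
  proof (cases "l < k")
    case True
    then have "2 ^ Suc l \<le> (2 ^ k :: nat)"
      by (intro power_increasing) auto
    then show ?thesis
      using that by simp
  next
    case lk: False
    then have "2 ^ Suc k \<le> (2 ^ l :: nat)"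
      using False by (intro power_increasing) auto
    then show ?thesis
      using assms(1) by simp
  qed
  then have "dyadic_block l (unit_vec (2 ^ k + i)) m = 0" if "m < 2 ^ l" for m
    using that by (simp add: dyadic_block_def unit_vec_def)
  then show ?thesis
    using False by (simp add: sylvester_form_def matrix_form_def)
qed

definition block_hadamard_form :: "real \<Rightarrow> (nat \<Rightarrow> real) \<Rightarrow> (nat \<Rightarrow> real) \<Rightarrow> real"
  where "block_hadamard_form t x y = (\<Sum>k. 2 powr (- (real k * t)) * sylvester_form k x y)"

lemma block_hadamard_form_unit_vec:
  assumes "i < 2 ^ k" "j < 2 ^ k"
  shows "block_hadamard_form t (unit_vec (2 ^ k + i)) (unit_vec (2 ^ k + j)) = 2 powr (- (real k * t)) * sylvester k i j"
proof -
  have "block_hadamard_form t (unit_vec (2 ^ k + i)) (unit_vec (2 ^ k + j)) =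
      (\<Sum>l. if l = k then 2 powr (- (real k * t)) * sylvester k i j else 0)"
    unfolding block_hadamard_form_def sylvester_form_unit_vec[OF assms]
    by (intro arg_cong[of _ _ suminf]) auto
  then show ?thesis
    using sums_unique[OF sums_single[of k "\<lambda>_. 2 powr (- (real k * t)) * sylvester k i j"]] by simp
qed

text \<open>
  The weight \<open>2 powr (- (k t))\<close> beats the growth of the \<open>k\<close>-th bound, so the series is dominated by
  a geometric one with ratio \<open>r = 2 powr (1/4 + p/8 - t)\<close>. The same domination makes the series
  converge, which is needed for bilinearity.
\<close>

lemma block_hadamard_form_continuous:
  assumes p: "1 \<le> p" "p < 2" and t: "1/4 + p/8 < t"
  shows "continuous_bilinear_form (lp_space p) (lp_norm p) (block_hadamard_form t)"
proof -
  define r where "r = 2 powr (1/4 + p/8 - t)"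
  have r: "0 < r" "r < 1"
    using t by (auto simp: r_def powr_less_one)
  define T where "T x y k = 2 powr (- (real k * t)) * sylvester_form k x y" for x y k
  have form: "block_hadamard_form t x y = suminf (T x y)" for x y
    by (simp add: block_hadamard_form_def T_def[abs_def])
  have le: "norm (T x y k) \<le> 3 * (lp_norm p x * lp_norm p y) * r ^ k"
    if "x \<in> lp_space p" "y \<in> lp_space p" for x y k
  proof -
    have rk: "r ^ k = 2 powr (- (real k * t)) * 2 powr (k * (1/4 + p/8))"
      by (simp add: r_def powr_power algebra_simps flip: powr_add)
    have "norm (T x y k) = 2 powr (- (real k * t)) * \<bar>sylvester_form k x y\<bar>"
      by (simp add: T_def abs_mult)
    also have "\<dots> \<le> 2 powr (- (real k * t)) * (3 * 2 powr (k * (1/4 + p/8)) * (lp_norm p x * lp_norm p y))"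
      by (intro mult_left_mono sylvester_form_bound p that) auto
    also have "\<dots> = 3 * (lp_norm p x * lp_norm p y) * r ^ k"
      unfolding rk by (simp only: mult_ac)
    finally show ?thesis .
  qed
  have geom: "summable (\<lambda>k. c * r ^ k)" for c
    using r by (intro summable_mult summable_geometric) auto
  have sm: "summable (T x y)" if "x \<in> lp_space p" "y \<in> lp_space p" for x y
    by (rule summable_comparison_test'[OF geom le[OF that]])
  have bilin: "bilinear_on (lp_space p) (\<lambda>x y. T x y k)" for k
    using sylvester_form_bilinear[of "lp_space p" k]
    by (simp add: bilinear_on_def T_def algebra_simps)
  have eqs: "T (x + y) z = (\<lambda>k. T x z k + T y z k)" "T z (x + y) = (\<lambda>k. T z x k + T z y k)"
    "T (c *\<^sub>R x) y = (\<lambda>k. c * T x y k)" "T x (c *\<^sub>R y) = (\<lambda>k. c * T x y k)"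
    if "x \<in> lp_space p" "y \<in> lp_space p" "z \<in> lp_space p" for x y z c
    using bilinear_on_add[OF bilin that] bilinear_on_scale[OF bilin that(1,2)] by auto
  have "bilinear_on (lp_space p) (block_hadamard_form t)"
    unfolding bilinear_on_def form
    by (simp add: eqs sm suminf_add suminf_mult)
  then show ?thesis
  proof (rule bounded_bilinear_form_continuous[OF real_banach_on_lp[OF p(1)]])
    fix x y assume xy: "x \<in> lp_space p" "y \<in> lp_space p"
    have "norm (suminf (T x y)) \<le> (\<Sum>k. 3 * (lp_norm p x * lp_norm p y) * r ^ k)"
      by (rule norm_suminf_le[OF le[OF xy] geom])
    also have "\<dots> = 3 / (1 - r) * (lp_norm p x * lp_norm p y)"
      using r by (simp add: suminf_mult suminf_geometric)
    finally show "\<bar>block_hadamard_form t x y\<bar> \<le> 3 / (1 - r) * (lp_norm p x * lp_norm p y)"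
      by (simp add: form)
  qed
qed

text \<open>
  The bound for a continuous majorant on the unit ball cannot depend on \<open>k\<close>, whereas the trace on
  block \<open>k\<close> forces it to be at least \<open>2 powr (k (1/2 - t))\<close>.
\<close>

lemma block_hadamard_form_not_delta_semidefinite:
  assumes p: "1 \<le> p" and b: "bilinear_on (lp_space p) (block_hadamard_form t)" and t: "t < 1/2"
  shows "\<not> delta_semidefinite (lp_space p) (lp_norm p) (\<lambda>x. block_hadamard_form t x x)"
    (is "\<not> delta_semidefinite ?X ?N _")
proof
  note X = real_banach_on_lp[OF p]
  let ?b = "block_hadamard_form t"
  assume "delta_semidefinite ?X ?N (\<lambda>x. ?b x x)"
  then obtain b1 b2 where b1: "continuous_bilinear_form ?X ?N b1" and b2: "continuous_bilinear_form ?X ?N b2"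
    and nonneg: "\<And>x. x \<in> ?X \<Longrightarrow> 0 \<le> b1 x x" "\<And>x. x \<in> ?X \<Longrightarrow> 0 \<le> b2 x x"
    and diff: "\<And>x. x \<in> ?X \<Longrightarrow> ?b x x = b1 x x - b2 x x"
    unfolding delta_semidefinite_def continuous_quadratic_form_def by metis
  define s where "s x y = b1 x y + b2 x y" for x y
  have s: "bilinear_on ?X s"
    using b1 b2 by (simp add: continuous_bilinear_form_def bilinear_on_def s_def algebra_simps)
  have major: "\<bar>?b x x\<bar> \<le> s x x" if "x \<in> ?X" for x
    using nonneg[OF that] diff[OF that] by (simp add: s_def)
  obtain C1 C2 where "\<And>x. x \<in> ?X \<Longrightarrow> ?N x \<le> 1 \<Longrightarrow> b1 x x \<le> C1"
    "\<And>x. x \<in> ?X \<Longrightarrow> ?N x \<le> 1 \<Longrightarrow> b2 x x \<le> C2"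
    using continuous_bilinear_form_bound[OF X b1] continuous_bilinear_form_bound[OF X b2] by metis
  then have C: "s (unit_vec n) (unit_vec n) \<le> C1 + C2" for n
    unfolding s_def by (intro add_mono) (auto intro: unit_vec_lp[OF p])
  have bounded: "(2 powr (1/2 - t)) ^ k \<le> C1 + C2" for k
  proof -
    let ?e = "\<lambda>i. unit_vec (2 ^ k + i)" and ?n = "2 ^ k :: nat"
    have "2 powr (- (real k * t)) * real ?n * sqrt (real ?n) \<le> (\<Sum>i<?n. s (?e i) (?e i))"
      by (rule hadamard_majorant_bound[OF subspace_lp_space[OF p] b s major symmetric_hadamard_sylvester])
        (auto intro: unit_vec_lp[OF p] block_hadamard_form_unit_vec)
    also have "\<dots> \<le> real ?n * (C1 + C2)"
      using sum_bounded_above[of "{..<?n}" "\<lambda>i. s (?e i) (?e i)" "C1 + C2"] C by simp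
    finally have "real ?n * (2 powr (- (real k * t)) * sqrt (real ?n)) \<le> real ?n * (C1 + C2)"
      by (simp only: mult_ac)
    then have "2 powr (- (real k * t)) * sqrt (real ?n) \<le> C1 + C2"
      by (rule mult_left_le_imp_le) simp
    moreover have "sqrt (real ?n) = 2 powr (k * (1/2))"
      by (simp add: powr_powr flip: powr_half_sqrt powr_realpow)
    ultimately show ?thesis
      by (simp add: powr_power algebra_simps flip: powr_add)
  qed
  have "1 < 2 powr (1/2 - t)"
    using t by simp
  then obtain k where "C1 + C2 < (2 powr (1/2 - t)) ^ k"
    using real_arch_pow by blast
  with bounded[of k] show False
    by simp
qed

theorem corollary1p7:
  fixes p :: real
  assumes "1 \<le> p" and "p < 2"
  shows "\<not> property_D (lp_space p) (lp_norm p)"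
proof -
  \<comment> \<open>The midpoint of \<open>1/4 + p/8\<close> and \<open>1/2\<close>.\<close>
  define t where "t = 3/8 + p/16"
  have "1/4 + p/8 < t" "t < 1/2"
    using assms by (auto simp: t_def)
  then have "continuous_quadratic_form (lp_space p) (lp_norm p) (\<lambda>x. block_hadamard_form t x x)"
    and "\<not> delta_semidefinite (lp_space p) (lp_norm p) (\<lambda>x. block_hadamard_form t x x)"
    using block_hadamard_form_continuous[OF assms, of t] block_hadamard_form_not_delta_semidefinite[OF assms(1), of t]
    by (auto simp: continuous_quadratic_form_def continuous_bilinear_form_def)
  then show ?thesis
    by (auto simp: property_D_def)
qed

end
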